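(* Let $F\colon\mathcal I\to\mathrm{Cat}_{[0,\infty]}$ be a small diagram of Lawvere metric spaces. Then for $a,b\in\operatorname{colim}(\mathrm{Ob}\circ F)$ the hom-distance $(\operatorname{colim}F)(a,b)$ is the infimum over sums of distances $$\inf\big\{d_{F(i_n)}(x_n,y_n)+\dots+d_{F(i_1)}(x_1,y_1)\big\},$$ taken over all finite sequences ($n\ge1$) of $i_k\in\mathcal I$ and points $x_k,y_k\in F(i_k)$ with compatible endpoints: $[y_{k-1}]=[x_k]$ in $\operatorname{colim}(\mathrm{Ob}\circ F)$ for $2\le k\le n$, $[x_1]=a$ and $[y_n]=b$.
   Context: A Lawvere metric space is a category $M$ enriched in the monoidal poset $([0,\infty],\ge)$ with addition as tensor product (and unit $0$): a set of points with distances $d_M(a,b)=M(a,b)\in[0,\infty]$ such that $M(b,c)+M(a,b)\ge M(a,c)$ and $0\ge M(a,a)$. $\mathrm{Cat}_{[0,\infty]}$ is the category of (small) Lawvere metric spaces whose morphisms $G\colon M\to N$ are the functions on points with $M(a,b)\ge N(Ga,Gb)$. $\mathrm{Ob}\colon\mathrm{Cat}_{[0,\infty]}\to\mathrm{Set}$ sends a space to its set of points; the set of points of $\operatorname{colim}F$ is $\operatorname{colim}(\mathrm{Ob}\circ F)$, and $[x]$ denotes the class there of a point $x\in F(i)$. The infimum of the empty set is $\infty$. *)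

theory Defs
  imports "HOL-Library.Extended_Nonnegative_Real" "HOL-Library.FuncSet"
begin

section \<open>Small categories\<close>

record ('i, 'm) cat =
  objs :: "'i set"
  arrs :: "'m set"
  source :: "'m \<Rightarrow> 'i"
  target :: "'m \<Rightarrow> 'i"
  ident :: "'i \<Rightarrow> 'm"
  comp_arr :: "'m \<Rightarrow> 'm \<Rightarrow> 'm"

text \<open>\<open>comp_arr I g f\<close> is \<open>g\<close> after \<open>f\<close>. Smallness is automatic, since objects and
  arrows are sets over HOL types.\<close>

definition small_category :: "('i, 'm) cat \<Rightarrow> bool" where
  "small_category I \<longleftrightarrow>
     (\<forall>f\<in>arrs I. source I f \<in> objs I \<and> target I f \<in> objs I) \<and>
     (\<forall>i\<in>objs I. ident I i \<in> arrs I \<and> source I (ident I i) = i \<and> target I (ident I i) = i) \<and>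
     (\<forall>f\<in>arrs I. \<forall>g\<in>arrs I. source I g = target I f \<longrightarrow>
        comp_arr I g f \<in> arrs I \<and> source I (comp_arr I g f) = source I f \<and>
        target I (comp_arr I g f) = target I g) \<and>
     (\<forall>f\<in>arrs I. comp_arr I f (ident I (source I f)) = f \<and>
        comp_arr I (ident I (target I f)) f = f) \<and>
     (\<forall>f\<in>arrs I. \<forall>g\<in>arrs I. \<forall>h\<in>arrs I. source I g = target I f \<longrightarrow> source I h = target I g \<longrightarrow>
        comp_arr I h (comp_arr I g f) = comp_arr I (comp_arr I h g) f)"


section \<open>Lawvere metric spaces\<close>

record 'p lawvere =
  Ob :: "'p set"
  hom_dist :: "'p \<Rightarrow> 'p \<Rightarrow> ennreal"

text \<open>Values of \<open>hom_dist M\<close> outside \<open>Ob M\<close> are irrelevant, and so are values of a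
  map outside the points of its domain.\<close>

definition lawvere_space :: "'p lawvere \<Rightarrow> bool" where
  "lawvere_space M \<longleftrightarrow>
     (\<forall>a\<in>Ob M. 0 \<ge> hom_dist M a a) \<and>
     (\<forall>a\<in>Ob M. \<forall>b\<in>Ob M. \<forall>c\<in>Ob M. hom_dist M b c + hom_dist M a b \<ge> hom_dist M a c)"

definition lawvere_map :: "'p lawvere \<Rightarrow> 'q lawvere \<Rightarrow> ('p \<Rightarrow> 'q) \<Rightarrow> bool" where
  "lawvere_map M N G \<longleftrightarrow>
     G \<in> Ob M \<rightarrow> Ob N \<and>
     (\<forall>a\<in>Ob M. \<forall>b\<in>Ob M. hom_dist M a b \<ge> hom_dist N (G a) (G b))"


section \<open>Diagrams\<close>

text \<open>All spaces of a diagram have their points in one type \<open>'p\<close>; the spaces need not be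
  disjoint, and any small family of spaces can be given this form.\<close>

record ('i, 'm, 'p) diagram =
  obj_map :: "'i \<Rightarrow> 'p lawvere"
  arr_map :: "'m \<Rightarrow> 'p \<Rightarrow> 'p"

definition lawvere_diagram :: "('i, 'm) cat \<Rightarrow> ('i, 'm, 'p) diagram \<Rightarrow> bool" where
  "lawvere_diagram I F \<longleftrightarrow>
     (\<forall>i\<in>objs I. lawvere_space (obj_map F i)) \<and>
     (\<forall>f\<in>arrs I. lawvere_map (obj_map F (source I f)) (obj_map F (target I f)) (arr_map F f)) \<and>
     (\<forall>i\<in>objs I. \<forall>x\<in>Ob (obj_map F i). arr_map F (ident I i) x = x) \<and>
     (\<forall>f\<in>arrs I. \<forall>g\<in>arrs I. source I g = target I f \<longrightarrow>
        (\<forall>x\<in>Ob (obj_map F (source I f)).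
           arr_map F (comp_arr I g f) x = arr_map F g (arr_map F f x)))"


section \<open>The colimit of the underlying sets\<close>

text \<open>For a set-valued diagram with values \<open>S i\<close> and transition maps \<open>\<phi> f\<close>, the colimit is
  the disjoint union of the \<open>S i\<close> modulo the equivalence relation generated by
  \<open>(i, x) \<sim> (j, \<phi> f x)\<close> for \<open>f : i \<rightarrow> j\<close>.\<close>

definition colim_rel ::
    "('i, 'm) cat \<Rightarrow> ('i \<Rightarrow> 'p set) \<Rightarrow> ('m \<Rightarrow> 'p \<Rightarrow> 'p) \<Rightarrow> (('i \<times> 'p) \<times> ('i \<times> 'p)) set" where
  "colim_rel I S \<phi> =
     {(u, v). u \<in> Sigma (objs I) S \<and> v \<in> Sigma (objs I) S \<and>
        equivclp (\<lambda>u v. \<exists>f\<in>arrs I. \<exists>x\<in>S (source I f).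
          u = (source I f, x) \<and> v = (target I f, \<phi> f x)) u v}"

definition set_colim ::
    "('i, 'm) cat \<Rightarrow> ('i \<Rightarrow> 'p set) \<Rightarrow> ('m \<Rightarrow> 'p \<Rightarrow> 'p) \<Rightarrow> ('i \<times> 'p) set set" where
  "set_colim I S \<phi> = Sigma (objs I) S // colim_rel I S \<phi>"

definition colim_Ob :: "('i, 'm) cat \<Rightarrow> ('i, 'm, 'p) diagram \<Rightarrow> ('i \<times> 'p) set set" where
  "colim_Ob I F = set_colim I (Ob \<circ> obj_map F) (arr_map F)"

definition point_class ::
    "('i, 'm) cat \<Rightarrow> ('i, 'm, 'p) diagram \<Rightarrow> 'i \<Rightarrow> 'p \<Rightarrow> ('i \<times> 'p) set" where
  "point_class I F i x = colim_rel I (Ob \<circ> obj_map F) (arr_map F) `` {(i, x)}"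


section \<open>Colimits of Lawvere metric spaces\<close>

definition cocone ::
    "('i, 'm) cat \<Rightarrow> ('i, 'm, 'p) diagram \<Rightarrow> 'q lawvere \<Rightarrow> ('i \<Rightarrow> 'p \<Rightarrow> 'q) \<Rightarrow> bool" where
  "cocone I F C \<iota> \<longleftrightarrow>
     lawvere_space C \<and>
     (\<forall>i\<in>objs I. lawvere_map (obj_map F i) C (\<iota> i)) \<and>
     (\<forall>f\<in>arrs I. \<forall>x\<in>Ob (obj_map F (source I f)).
        \<iota> (target I f) (arr_map F f x) = \<iota> (source I f) x)"

text \<open>HOL cannot quantify over types inside a formula, so the universal property is
  relative to test spaces \<open>N\<close> with points in a type \<open>'u\<close>. The mediating map is taken
  extensional so that its uniqueness means uniqueness on \<open>Ob C\<close>.\<close>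

definition colimit_cocone ::
    "'u itself \<Rightarrow> ('i, 'm) cat \<Rightarrow> ('i, 'm, 'p) diagram \<Rightarrow> 'q lawvere \<Rightarrow> ('i \<Rightarrow> 'p \<Rightarrow> 'q) \<Rightarrow> bool"
  where
  "colimit_cocone T I F C \<iota> \<longleftrightarrow>
     cocone I F C \<iota> \<and>
     (\<forall>(N :: 'u lawvere) \<kappa>. cocone I F N \<kappa> \<longrightarrow>
        (\<exists>!h. h \<in> extensional (Ob C) \<and> lawvere_map C N h \<and>
           (\<forall>i\<in>objs I. \<forall>x\<in>Ob (obj_map F i). h (\<iota> i x) = \<kappa> i x)))"

text \<open>\<open>C\<close> is the colimit of \<open>F\<close>, normalised so that its points are
  \<open>colim (Ob \<circ> F)\<close> and its coprojections send a point to its class.\<close>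

definition is_colim ::
    "'u itself \<Rightarrow> ('i, 'm) cat \<Rightarrow> ('i, 'm, 'p) diagram \<Rightarrow> ('i \<times> 'p) set lawvere \<Rightarrow> bool" where
  "is_colim T I F C \<longleftrightarrow>
     Ob C = colim_Ob I F \<and> colimit_cocone T I F C (point_class I F)"

end

theory Submission imports Defs begin

text \<open>
  Equip the set-level colimit with the infimum of the lengths of all zigzags. A map out of it that
  is induced by a cocone cannot increase distances: along a zigzag, the legs of the cocone bound
  each summand from below and the triangle inequality in the target does the rest. Conversely the
  distance of an arbitrary colimit is at most every zigzag length for the same reason, and at
  least the infimum because its mediating map into the explicit colimit is the identity on points.
\<close>

section \<open>Zigzags and their lengths\<close>

text \<open>The inductive form supports induction along the chain. Compatibility of endpoints is
  built into \<open>snoc\<close>: the class where the chain ends must be that of the start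
  \<open>x\<close> of the next segment.\<close>

inductive zigzag ::
    "('i, 'm) cat \<Rightarrow> ('i, 'm, 'p) diagram \<Rightarrow> ('i \<times> 'p) set \<Rightarrow> ('i \<times> 'p) set \<Rightarrow> ennreal \<Rightarrow> bool"
  for I F where
  single: "\<lbrakk>i \<in> objs I; x \<in> Ob (obj_map F i); y \<in> Ob (obj_map F i)\<rbrakk> \<Longrightarrow>
    zigzag I F (point_class I F i x) (point_class I F i y) (hom_dist (obj_map F i) x y)"
| snoc: "\<lbrakk>zigzag I F a (point_class I F i x) r;
    i \<in> objs I; x \<in> Ob (obj_map F i); y \<in> Ob (obj_map F i)\<rbrakk> \<Longrightarrow>
    zigzag I F a (point_class I F i y) (r + hom_dist (obj_map F i) x y)"

text \<open>Concatenation is the source of the triangle inequality in the colimit. Induction is on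
  the second chain, since \<open>snoc\<close> extends chains at their end.\<close>

lemma zigzag_append:
  assumes "zigzag I F b c s" "zigzag I F a b r"
  shows "zigzag I F a c (r + s)"
  using assms
proof (induction rule: zigzag.induct)
  case (single i x y)
  then show ?case by (blast intro: zigzag.snoc)
next
  case (snoc b i x s y)
  then have "zigzag I F a (point_class I F i y) ((r + s) + hom_dist (obj_map F i) x y)"
    by (blast intro: zigzag.snoc)
  then show ?case by (simp add: add.assoc)
qed

text \<open>Sequences are total functions read only at the indices 1 to \<open>n\<close>. Joints
  start at \<open>k = 2\<close>, so \<open>k - 1\<close> is never truncated.\<close>

definition compatible ::
    "('i, 'm) cat \<Rightarrow> ('i, 'm, 'p) diagram \<Rightarrow> nat \<Rightarrow> (nat \<Rightarrow> 'i) \<Rightarrow> (nat \<Rightarrow> 'p) \<Rightarrow> (nat \<Rightarrow> 'p) \<Rightarrow> bool"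
  where
  "compatible I F n i x y \<longleftrightarrow>
     (\<forall>k\<in>{1..n}. i k \<in> objs I \<and> x k \<in> Ob (obj_map F (i k)) \<and> y k \<in> Ob (obj_map F (i k))) \<and>
     (\<forall>k\<in>{2..n}. point_class I F (i (k - 1)) (y (k - 1)) = point_class I F (i k) (x k))"

lemma zigzag_imp_compatible:
  assumes "zigzag I F a b r"
  shows "\<exists>n i x y. n \<ge> 1 \<and> compatible I F n i x y \<and>
    point_class I F (i 1) (x 1) = a \<and> point_class I F (i n) (y n) = b \<and>
    r = (\<Sum>k=1..n. hom_dist (obj_map F (i k)) (x k) (y k))"
  using assms
proof (induction rule: zigzag.induct)
  case (single i x y)
  then show ?case
    by - (rule exI[of _ 1], rule exI[of _ "\<lambda>_. i"], rule exI[of _ "\<lambda>_. x"],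
        rule exI[of _ "\<lambda>_. y"], simp add: compatible_def)
next
  case (snoc a j u r v)
  then obtain n i x y where n: "n \<ge> 1" and c: "compatible I F n i x y"
    and a: "point_class I F (i 1) (x 1) = a"
    and b: "point_class I F (i n) (y n) = point_class I F j u"
    and r: "r = (\<Sum>k=1..n. hom_dist (obj_map F (i k)) (x k) (y k))"
    by blast
  \<comment> \<open>The new segment is written at index \<open>Suc n\<close>; values at 1 to
    \<open>n\<close>, hence the old sum, stay the same.\<close>
  let ?i = "i(Suc n := j)" and ?x = "x(Suc n := u)" and ?y = "y(Suc n := v)"
  have "(\<Sum>k=1..n. hom_dist (obj_map F (?i k)) (?x k) (?y k)) = r"
    unfolding r by (rule sum.cong) auto
  moreover have "compatible I F (Suc n) ?i ?x ?y"
    unfolding compatible_def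
  proof (intro conjI ballI)
    fix k assume "k \<in> {2..Suc n}"
    \<comment> \<open>Only the joint at \<open>k = Suc n\<close> is new, and there \<open>b\<close>
      applies. At old joints the two inequalities make the updates invisible.\<close>
    then consider "k = Suc n" | "k \<in> {2..n}" "k - 1 \<noteq> Suc n" "k \<noteq> Suc n" by fastforce
    then show "point_class I F (?i (k - 1)) (?y (k - 1)) = point_class I F (?i k) (?x k)"
      by cases (use n b c in \<open>auto simp: compatible_def\<close>)
  qed (use c snoc.hyps in \<open>auto simp: compatible_def\<close>)
  ultimately show ?case
    using n a
    by - (rule exI[of _ "Suc n"], rule exI[of _ ?i], rule exI[of _ ?x], rule exI[of _ ?y], simp add: fun_upd_def)
qed

lemma compatible_imp_zigzag:
  assumes "n \<ge> 1" "compatible I F n i x y"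
  shows "zigzag I F (point_class I F (i 1) (x 1)) (point_class I F (i n) (y n))
    (\<Sum>k=1..n. hom_dist (obj_map F (i k)) (x k) (y k))"
  using assms
proof (induction n rule: dec_induct)
  case base
  then show ?case by (simp add: compatible_def zigzag.single)
next
  case (step n)
  have "compatible I F n i x y"
    using step.prems by (simp add: compatible_def)
  \<comment> \<open>This is the joint condition at \<open>k = Suc n\<close>, which lies in
    \<open>{2..Suc n}\<close> because \<open>n \<ge> 1\<close>.\<close>
  moreover have "point_class I F (i n) (y n) = point_class I F (i (Suc n)) (x (Suc n))"
    using conjunct2[OF step.prems[unfolded compatible_def], THEN bspec, of "Suc n"] step.hyps
    by simp
  ultimately have "zigzag I F (point_class I F (i 1) (x 1))
      (point_class I F (i (Suc n)) (x (Suc n)))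
      (\<Sum>k=1..n. hom_dist (obj_map F (i k)) (x k) (y k))"
    using step.IH by simp
  then have "zigzag I F (point_class I F (i 1) (x 1)) (point_class I F (i (Suc n)) (y (Suc n)))
      ((\<Sum>k=1..n. hom_dist (obj_map F (i k)) (x k) (y k))
        + hom_dist (obj_map F (i (Suc n))) (x (Suc n)) (y (Suc n)))"
    by (rule zigzag.snoc) (use step.prems in \<open>auto simp: compatible_def\<close>)
  then show ?case by simp
qed

text \<open>Bridge between the indexed sums of the theorem and the inductive chains on which all
  later arguments work.\<close>

lemma zigzag_lengths:
  "{r. zigzag I F a b r} =
     {(\<Sum>k=1..n. hom_dist (obj_map F (i k)) (x k) (y k)) | (n::nat) i x y.
        n \<ge> 1 \<and>
        (\<forall>k\<in>{1..n}. i k \<in> objs I \<and>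
           x k \<in> Ob (obj_map F (i k)) \<and> y k \<in> Ob (obj_map F (i k))) \<and>
        (\<forall>k\<in>{2..n}. point_class I F (i (k - 1)) (y (k - 1)) = point_class I F (i k) (x k)) \<and>
        point_class I F (i 1) (x 1) = a \<and>
        point_class I F (i n) (y n) = b}" (is "?L = ?R")
proof (intro set_eqI iffI)
  fix r assume "r \<in> ?L"
  then obtain n i x y where "n \<ge> 1" "compatible I F n i x y"
    "point_class I F (i 1) (x 1) = a" "point_class I F (i n) (y n) = b"
    "r = (\<Sum>k=1..n. hom_dist (obj_map F (i k)) (x k) (y k))"
    using zigzag_imp_compatible by blast
  then show "r \<in> ?R"
    unfolding compatible_def mem_Collect_eq by blast
next
  fix r assume "r \<in> ?R"
  then obtain n i x y where "n \<ge> 1" "compatible I F n i x y"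
    "point_class I F (i 1) (x 1) = a" "point_class I F (i n) (y n) = b"
    "r = (\<Sum>k=1..n. hom_dist (obj_map F (i k)) (x k) (y k))"
    unfolding compatible_def mem_Collect_eq by blast
  then show "r \<in> ?L"
    using compatible_imp_zigzag[of n I F i x y] by simp
qed

section \<open>The colimit of the point sets\<close>

lemma equiv_colim_rel: "equiv (Sigma (objs I) S) (colim_rel I S \<phi>)"
proof (rule equivI)
  show "colim_rel I S \<phi> \<subseteq> Sigma (objs I) S \<times> Sigma (objs I) S"
    by (auto simp: colim_rel_def)
  show "refl_on (Sigma (objs I) S) (colim_rel I S \<phi>)"
    by (auto simp: refl_on_def colim_rel_def)
  show "sym (colim_rel I S \<phi>)"
    unfolding sym_def colim_rel_def by (blast intro: equivclp_sym)
  show "trans (colim_rel I S \<phi>)"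
    unfolding trans_def colim_rel_def by (blast intro: equivclp_trans)
qed

lemma point_class_in_colim_Ob:
  "\<lbrakk>i \<in> objs I; x \<in> Ob (obj_map F i)\<rbrakk> \<Longrightarrow> point_class I F i x \<in> colim_Ob I F"
  unfolding point_class_def colim_Ob_def set_colim_def by (rule quotientI) simp

lemma colim_Ob_cases:
  assumes "a \<in> colim_Ob I F"
  obtains i x where "i \<in> objs I" "x \<in> Ob (obj_map F i)" "a = point_class I F i x"
  using assms unfolding colim_Ob_def set_colim_def point_class_def
  by (elim quotientE SigmaE) auto

lemma point_class_arr_map:
  assumes "small_category I" "lawvere_diagram I F"
    and "f \<in> arrs I" "x \<in> Ob (obj_map F (source I f))"
  shows "point_class I F (target I f) (arr_map F f x) = point_class I F (source I f) x"
proof -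
  have "((source I f, x), (target I f, arr_map F f x))
      \<in> colim_rel I (Ob \<circ> obj_map F) (arr_map F)"
    unfolding colim_rel_def
    using assms
    by (auto simp: small_category_def lawvere_diagram_def lawvere_map_def intro!: r_into_equivclp)
  then show ?thesis
    unfolding point_class_def using equiv_class_eq[OF equiv_colim_rel] by metis
qed

text \<open>The cocone equations give equality on generating pairs, and equality survives the
  equivalence closure. Hence the legs descend to classes.\<close>

lemma cocone_respects_colim_rel:
  assumes "cocone I F N \<kappa>" "(u, v) \<in> colim_rel I (Ob \<circ> obj_map F) (arr_map F)"
  shows "case_prod \<kappa> u = case_prod \<kappa> v"
proof -
  have "equivclp (\<lambda>u v. \<exists>f\<in>arrs I. \<exists>x\<in>(Ob \<circ> obj_map F) (source I f).
      u = (source I f, x) \<and> v = (target I f, arr_map F f x)) u v"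
    using assms(2) by (simp add: colim_rel_def)
  then show ?thesis
    by (induction rule: equivclp_induct) (use assms(1) in \<open>auto simp: cocone_def\<close>)
qed

lemma cocone_factors:
  assumes "cocone I F N \<kappa>"
  obtains h where "h \<in> extensional (colim_Ob I F)"
    and "\<And>i x. \<lbrakk>i \<in> objs I; x \<in> Ob (obj_map F i)\<rbrakk> \<Longrightarrow> h (point_class I F i x) = \<kappa> i x"
proof
  \<comment> \<open>The value on a class is read off an arbitrarily chosen representative;
    \<open>restrict\<close> makes the map extensional.\<close>
  let ?h = "restrict (\<lambda>c. case_prod \<kappa> (SOME u. u \<in> c)) (colim_Ob I F)"
  show "?h \<in> extensional (colim_Ob I F)" by simp
  fix i x assume ix: "i \<in> objs I" "x \<in> Ob (obj_map F i)"
  have "(i, x) \<in> point_class I F i x"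
    unfolding point_class_def by (rule equiv_class_self[OF equiv_colim_rel]) (use ix in simp)
  then have "(SOME u. u \<in> point_class I F i x) \<in> point_class I F i x"
    by (rule someI)
  then have "case_prod \<kappa> (i, x) = case_prod \<kappa> (SOME u. u \<in> point_class I F i x)"
    by (intro cocone_respects_colim_rel[OF assms]) (simp add: point_class_def)
  then show "?h (point_class I F i x) = \<kappa> i x"
    using point_class_in_colim_Ob[OF ix] by simp
qed

section \<open>Zigzag bounds and infima\<close>

text \<open>Membership of \<open>h a\<close> in \<open>Ob N\<close> is carried through the induction
  because the triangle inequality of \<open>N\<close> holds only for its points.\<close>

lemma cocone_map_le_zigzag:
  assumes "cocone I F N \<kappa>"
    and h: "\<And>i x. \<lbrakk>i \<in> objs I; x \<in> Ob (obj_map F i)\<rbrakk> \<Longrightarrow> h (point_class I F i x) = \<kappa> i x"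
    and "zigzag I F a b r"
  shows "h a \<in> Ob N \<and> hom_dist N (h a) (h b) \<le> r"
  using assms(3)
proof (induction rule: zigzag.induct)
  case (single i x y)
  then show ?case
    using assms(1) by (auto simp: h cocone_def lawvere_map_def)
next
  case (snoc a i x r y)
  have xy: "\<kappa> i x \<in> Ob N" "\<kappa> i y \<in> Ob N"
      "hom_dist N (\<kappa> i x) (\<kappa> i y) \<le> hom_dist (obj_map F i) x y"
    using assms(1) snoc.hyps by (auto simp: cocone_def lawvere_map_def)
  have "hom_dist N (h a) (\<kappa> i y) \<le> hom_dist N (\<kappa> i x) (\<kappa> i y) + hom_dist N (h a) (\<kappa> i x)"
    using assms(1) snoc.IH xy by (auto simp: cocone_def lawvere_space_def)
  also have "\<dots> \<le> hom_dist (obj_map F i) x y + r"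
    using snoc.IH xy snoc.hyps by (intro add_mono) (auto simp: h)
  finally show ?case
    using snoc by (simp add: h add.commute)
qed

text \<open>Adding a constant is monotone and continuous from the right at \<open>Inf A\<close>, so
  it commutes with the infimum.\<close>

lemma Inf_add_const_ennreal:
  fixes A :: "ennreal set"
  assumes "A \<noteq> {}"
  shows "Inf A + c = (INF r\<in>A. r + c)"
  using continuous_at_Inf_mono[of "\<lambda>x. x + c" A] assms
    continuous_add[of "at_right (Inf A)" "\<lambda>x. x" "\<lambda>x. c"]
  by (auto simp: mono_def add_right_mono)

text \<open>Turns a bound for all concatenated chains into the triangle inequality between infima,
  passing to the infimum in one summand at a time.\<close>

lemma le_Inf_add_Inf_ennreal:
  fixes t :: ennreal
  assumes "\<And>r s. \<lbrakk>r \<in> A; s \<in> B\<rbrakk> \<Longrightarrow> t \<le> r + s"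
  shows "t \<le> Inf A + Inf B"
\<comment> \<open>If one set is empty, its infimum is \<infinity> and the bound is trivial; the
  closing \<open>auto\<close> handles this case.\<close>
proof (cases "A = {} \<or> B = {}")
  case False
  have "t \<le> r + Inf B" if "r \<in> A" for r
  proof -
    have "t \<le> (INF s\<in>B. s + r)"
      by (rule INF_greatest) (metis assms that add.commute)
    then show ?thesis
      using False by (simp add: Inf_add_const_ennreal add.commute[of r])
  qed
  then have "t \<le> (INF r\<in>A. r + Inf B)"
    by (rule INF_greatest)
  then show ?thesis
    using False by (simp add: Inf_add_const_ennreal)
qed auto

section \<open>The explicit colimit and its universal property\<close>

text \<open>The formula is assumed only on points of the colimit, so the lemma covers both the
  explicit space and any \<open>C\<close> whose distances are already known. The type
  \<open>'u\<close> of test points is arbitrary.\<close>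

lemma is_colimI:
  fixes I :: "('i, 'm) cat" and F :: "('i, 'm, 'p) diagram"
  assumes "small_category I" "lawvere_diagram I F" and C: "Ob C = colim_Ob I F"
    and d: "\<And>a b. \<lbrakk>a \<in> colim_Ob I F; b \<in> colim_Ob I F\<rbrakk> \<Longrightarrow>
      hom_dist C a b = Inf {r. zigzag I F a b r}"
  shows "is_colim TYPE('u) I F C"
  unfolding is_colim_def colimit_cocone_def
proof (intro conjI allI impI)
  \<comment> \<open>The one-segment chain from a representative to itself has length 0.\<close>
  have "hom_dist C a a \<le> 0" if mem: "a \<in> colim_Ob I F" for a
  proof -
    obtain i x where ix: "i \<in> objs I" "x \<in> Ob (obj_map F i)" and a: "a = point_class I F i x"
      using mem by (rule colim_Ob_cases)
    have "hom_dist C a a \<le> hom_dist (obj_map F i) x x"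
      unfolding d[OF mem mem] unfolding a using ix by (auto intro: Inf_lower zigzag.single)
    also have "\<dots> \<le> 0"
      using assms(2) ix by (simp add: lawvere_diagram_def lawvere_space_def)
    finally show ?thesis .
  qed
  \<comment> \<open>The enriched order of summands puts the second chain first, whereas
    \<open>zigzag_append\<close> adds the first chain first; hence the commutation.\<close>
  moreover have "hom_dist C a c \<le> hom_dist C b c + hom_dist C a b"
    if "a \<in> colim_Ob I F" "b \<in> colim_Ob I F" "c \<in> colim_Ob I F" for a b c
    unfolding d[OF that(1,2)] d[OF that(2,3)] d[OF that(1,3)]
    by (rule le_Inf_add_Inf_ennreal, rule Inf_lower, subst add.commute)
      (auto intro: zigzag_append)
  ultimately have space: "lawvere_space C"
    by (simp add: lawvere_space_def C)
  have "lawvere_map (obj_map F i) C (point_class I F i)" if "i \<in> objs I" for i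
    using that
    by (auto simp: lawvere_map_def C d point_class_in_colim_Ob intro: Inf_lower zigzag.single)
  then show "cocone I F C (point_class I F)"
    using space point_class_arr_map[OF assms(1,2)] by (simp add: cocone_def)
  fix N :: "'u lawvere" and \<kappa> assume N: "cocone I F N \<kappa>"
  obtain h where ext: "h \<in> extensional (colim_Ob I F)"
    and h: "\<And>i x. \<lbrakk>i \<in> objs I; x \<in> Ob (obj_map F i)\<rbrakk> \<Longrightarrow> h (point_class I F i x) = \<kappa> i x"
    using cocone_factors[OF N] by blast
  show "\<exists>!h. h \<in> extensional (Ob C) \<and> lawvere_map C N h \<and>
      (\<forall>i\<in>objs I. \<forall>x\<in>Ob (obj_map F i). h (point_class I F i x) = \<kappa> i x)"
  proof (rule ex1I)
    have "h a \<in> Ob N" if "a \<in> colim_Ob I F" for a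
      using that by (rule colim_Ob_cases) (use N in \<open>auto simp: h cocone_def lawvere_map_def\<close>)
    moreover have "hom_dist N (h a) (h b) \<le> hom_dist C a b"
      if "a \<in> colim_Ob I F" "b \<in> colim_Ob I F" for a b
      unfolding d[OF that] using cocone_map_le_zigzag[OF N h] by (auto intro!: Inf_greatest)
    ultimately show "h \<in> extensional (Ob C) \<and> lawvere_map C N h \<and>
      (\<forall>i\<in>objs I. \<forall>x\<in>Ob (obj_map F i). h (point_class I F i x) = \<kappa> i x)"
      using ext h by (simp add: C lawvere_map_def)
  next
    fix g assume g: "g \<in> extensional (Ob C) \<and> lawvere_map C N g \<and>
      (\<forall>i\<in>objs I. \<forall>x\<in>Ob (obj_map F i). g (point_class I F i x) = \<kappa> i x)"
    show "g = h"
    proof (rule extensionalityI[of _ "colim_Ob I F"])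
      \<comment> \<open>Every point is a class of some \<open>x\<close>, so the legs force both
        values.\<close>
      fix a assume "a \<in> colim_Ob I F"
      then show "g a = h a"
        by (rule colim_Ob_cases) (simp add: g h)
    qed (use g ext C in auto)
  qed
qed (fact C)

text \<open>The test type \<open>('i \<times> 'p) set\<close> is that of the explicit colimit, which
  can therefore serve as a test space for \<open>C\<close>.\<close>

lemma is_colim_hom_dist:
  fixes I :: "('i, 'm) cat" and F :: "('i, 'm, 'p) diagram"
  assumes "small_category I" "lawvere_diagram I F"
    and C: "is_colim TYPE(('i \<times> 'p) set) I F C"
    and a: "a \<in> colim_Ob I F" and b: "b \<in> colim_Ob I F"
  shows "hom_dist C a b = Inf {r. zigzag I F a b r}"
proof (rule antisym)
  have "cocone I F C (point_class I F)"
    using C by (simp add: is_colim_def colimit_cocone_def)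
  \<comment> \<open>The zigzag bound is applied to the coprojections of \<open>C\<close> itself,
    with the identity as the induced map.\<close>
  then show "hom_dist C a b \<le> Inf {r. zigzag I F a b r}"
    using cocone_map_le_zigzag[of I F C "point_class I F" "\<lambda>c. c"] by (auto intro!: Inf_greatest)
next
  let ?D = "\<lparr>Ob = colim_Ob I F, hom_dist = \<lambda>a b. Inf {r. zigzag I F a b r}\<rparr>"
  have "is_colim TYPE(('i \<times> 'p) set) I F ?D"
    using assms(1,2) by (rule is_colimI) simp_all
  then have "cocone I F ?D (point_class I F)"
    by (simp add: is_colim_def colimit_cocone_def)
  then obtain h where h: "lawvere_map C ?D h"
    and eq: "\<forall>i\<in>objs I. \<forall>x\<in>Ob (obj_map F i). h (point_class I F i x) = point_class I F i x"
    using C unfolding is_colim_def colimit_cocone_def by blast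
  \<comment> \<open>Since \<open>h\<close> fixes every class, its non-expansiveness is exactly the
    missing inequality.\<close>
  have "h c = c" if "c \<in> colim_Ob I F" for c
    using that by (rule colim_Ob_cases) (simp add: eq)
  then show "Inf {r. zigzag I F a b r} \<le> hom_dist C a b"
    using h a b C by (auto simp: lawvere_map_def is_colim_def)
qed

theorem corollary5p4:
  fixes I :: "('i, 'm) cat" and F :: "('i, 'm, 'p) diagram"
  assumes "small_category I" and "lawvere_diagram I F"
  shows
    "(\<exists>C. is_colim TYPE(('i \<times> 'p) set) I F C) \<and>
     (\<forall>C. is_colim TYPE(('i \<times> 'p) set) I F C \<longrightarrow>
        is_colim TYPE('u) I F C \<and>
        (\<forall>a\<in>colim_Ob I F. \<forall>b\<in>colim_Ob I F.
           hom_dist C a b =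
             Inf {(\<Sum>k=1..n. hom_dist (obj_map F (i k)) (x k) (y k)) | (n::nat) i x y.
                n \<ge> 1 \<and>
                (\<forall>k\<in>{1..n}. i k \<in> objs I \<and>
                   x k \<in> Ob (obj_map F (i k)) \<and> y k \<in> Ob (obj_map F (i k))) \<and>
                (\<forall>k\<in>{2..n}. point_class I F (i (k - 1)) (y (k - 1)) = point_class I F (i k) (x k)) \<and>
                point_class I F (i 1) (x 1) = a \<and>
                point_class I F (i n) (y n) = b}))"
  unfolding zigzag_lengths[symmetric]
proof (intro conjI allI impI ballI)
  show "\<exists>C. is_colim TYPE(('i \<times> 'p) set) I F C"
    using is_colimI[OF assms, of
        "\<lparr>Ob = colim_Ob I F, hom_dist = \<lambda>a b. Inf {r. zigzag I F a b r}\<rparr>"] by auto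
next
  fix C assume C: "is_colim TYPE(('i \<times> 'p) set) I F C"
  \<comment> \<open>Testing on one type determines the distances of \<open>C\<close>, and these in
    turn give the universal property for test spaces over \<open>'u\<close>.\<close>
  then show "is_colim TYPE('u) I F C"
    using is_colim_hom_dist[OF assms C] by (intro is_colimI[OF assms]) (simp_all add: is_colim_def)
  fix a b assume "a \<in> colim_Ob I F" "b \<in> colim_Ob I F"
  then show "hom_dist C a b = Inf {r. zigzag I F a b r}"
    by (rule is_colim_hom_dist[OF assms C])
qed

end
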